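(* Let $b\in C^1(\mathbb R)$ have bounded derivative and assume that there exists $\mathfrak m_b>0$ such that $b'(x)\leqslant-\mathfrak m_b$ for every $x\in\mathbb R$. Let $X$ be the stationary solution of $X_t=X_0+\int_0^tb(X_s)\,ds+\sigma B_t$, $t\in\mathbb R_+$, let $f$ be the density of $X_0$, and assume that $f\in\mathbb L^2(\mathbb R,dr)$. Let $\mathcal B_m=\{\varphi_1,\dots,\varphi_m\}$ be an orthonormal family of $\mathbb L^2(I,dr)$ whose elements are bounded and Lipschitz continuous functions, and let $\mathcal S_m$ be the vector space generated by $\mathcal B_m$. Then the projection estimator $$\widehat f_m:=\sum_{j=1}^m\left(\frac1n\sum_{i=1}^n\varphi_j(X_{t_i})\right)\varphi_j$$ satisfies $$\mathbb E(\|\widehat f_m-f\|^2)\leqslant\min_{t\in\mathcal S_m}\|t-f\|^2+2\mathfrak c\frac{mL(m)}{(n\Delta_n)^{\mathfrak b_H}}\quad\text{with}\quad L(m):=\sum_{j=1}^m\|\varphi_j\|_{\rm Lip}^2,$$ where $\mathfrak c$ is the constant of the concentration inequality recalled in the context.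
   Context: Equation and sampling. $B=(B_t)_{t\in\mathbb R_+}$ is a fractional Brownian motion of Hurst index $H\in(0,1)$ and $\sigma\in\mathbb R\setminus\{0\}$. Under the stated conditions on $b$ ($b\in C^1(\mathbb R)$, $b'$ bounded, $b'\leqslant-\mathfrak m_b<0$), it is known that the equation $X_t=X_0+\int_0^tb(X_s)ds+\sigma B_t$ has a unique stationary solution $X=(X_t)_{t\in\mathbb R_+}$ (in particular $X_t$ has the same distribution as $X_0$ for every $t$), and that $X_0$ has a density $f$ with respect to Lebesgue's measure. The process is observed at times $t_i:=i\Delta_n$, $i\in\{1,\dots,n\}$, where $\Delta_n>0$, $\lim_{n\to\infty}\Delta_n=0$ and $\lim_{n\to\infty}n\Delta_n=\infty$. Put $\mathfrak a_H:=(2H)\vee1$ and $\mathfrak b_H:=1\wedge(2-2H)$. Known concentration inequality (defining the constant $\mathfrak c$). $\mathbb R^n$ is equipped with the distance $d_1(\mathbf x,\mathbf y)=\sum_{i=1}^n|\mathbf y_i-\mathbf x_i|$, and $\|\cdot\|_{\rm Lip}$ denotes the Lipschitz semi-norm (best Lipschitz constant). Under the stated conditions on $b$ it is known (Bertin, Klutchnikoff, Panloup and Varvenne) that there exists a constant $\mathfrak c>0$, not depending on $n$, such that for every Lipschitz map $F:(\mathbb R^n,d_1)\to\mathbb R$ and every $r>0$, $$\mathbb P(F(X_{t_1},\dots,X_{t_n})-\mathbb E(F(X_{t_1},\dots,X_{t_n}))>r)\leqslant\exp\left(-\frac{r^2}{\mathfrak c\|F\|_{\rm Lip}^2n^{\mathfrak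 a_H}\Delta_n^{-\mathfrak b_H}}\right)$$ (the right-hand side being read as $0$ if $\|F\|_{\rm Lip}=0$). Such a constant $\mathfrak c$ is fixed. Function spaces. $I\subset\mathbb R$ is an interval, $m\in\mathbb N\setminus\{0\}$, and $\|\cdot\|$ is the usual norm of $\mathbb L^2(I,dr)$. Functions on $I$ are identified with functions on $\mathbb R$ supported in $I$, and Lipschitz semi-norms are those of the corresponding functions on $\mathbb R$. *)

theory Defs
  imports "HOL-Probability.Probability"
begin

definition gaussian_rv :: "'a measure \<Rightarrow> ('a \<Rightarrow> real) \<Rightarrow> bool"
  (* Point masses count as Gaussian laws of variance zero. *)
  where "gaussian_rv M Y \<longleftrightarrow> Y \<in> borel_measurable M \<and>
    ((\<exists>\<mu>. AE \<omega> in M. Y \<omega> = \<mu>) \<or>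
     (\<exists>\<mu> s. s > 0 \<and> distributed M lborel Y (\<lambda>x. ennreal (normal_density \<mu> s x))))"

definition gaussian_process :: "'a measure \<Rightarrow> 'i set \<Rightarrow> ('i \<Rightarrow> 'a \<Rightarrow> real) \<Rightarrow> bool"
  where "gaussian_process M T Y \<longleftrightarrow>
    (\<forall>J a. finite J \<and> J \<subseteq> T \<longrightarrow> gaussian_rv M (\<lambda>\<omega>. \<Sum>t\<in>J. a t * Y t \<omega>))"

definition fractional_brownian_motion ::
    "'a measure \<Rightarrow> real \<Rightarrow> (real \<Rightarrow> 'a \<Rightarrow> real) \<Rightarrow> bool"
  where "fractional_brownian_motion M H B \<longleftrightarrow>
    gaussian_process M {0..} B \<and>
    (\<forall>t\<ge>0. (\<integral>\<omega>. B t \<omega> \<partial>M) = 0) \<and>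
    (\<forall>s\<ge>0. \<forall>t\<ge>0. (\<integral>\<omega>. B s \<omega> * B t \<omega> \<partial>M)
        = (s powr (2 * H) + t powr (2 * H) - \<bar>t - s\<bar> powr (2 * H)) / 2) \<and>
    (AE \<omega> in M. continuous_on {0..} (\<lambda>t. B t \<omega>))"

definition stationary_process :: "'a measure \<Rightarrow> (real \<Rightarrow> 'a \<Rightarrow> real) \<Rightarrow> bool"
  where "stationary_process M X \<longleftrightarrow>
    (\<forall>t\<ge>0. X t \<in> borel_measurable M) \<and>
    (\<forall>J h. finite J \<and> J \<subseteq> {0..} \<and> h \<ge> 0 \<longrightarrow>
       distr M (PiM J (\<lambda>_. borel)) (\<lambda>\<omega>. \<lambda>t\<in>J. X (t + h) \<omega>)
     = distr M (PiM J (\<lambda>_. borel)) (\<lambda>\<omega>. \<lambda>t\<in>J. X t \<omega>))"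

definition sde_solution ::
    "'a measure \<Rightarrow> (real \<Rightarrow> real) \<Rightarrow> real \<Rightarrow> (real \<Rightarrow> 'a \<Rightarrow> real) \<Rightarrow> (real \<Rightarrow> 'a \<Rightarrow> real) \<Rightarrow> bool"
  where "sde_solution M b \<sigma> B X \<longleftrightarrow>
    (\<forall>t\<ge>0. X t \<in> borel_measurable M) \<and>
    (AE \<omega> in M. continuous_on {0..} (\<lambda>t. X t \<omega>) \<and>
       (\<forall>t\<ge>0. X t \<omega> = X 0 \<omega> + (LBINT s:{0..t}. b (X s \<omega>)) + \<sigma> * B t \<omega>))"

definition stationary_solution ::
    "'a measure \<Rightarrow> (real \<Rightarrow> real) \<Rightarrow> real \<Rightarrow> (real \<Rightarrow> 'a \<Rightarrow> real) \<Rightarrow> (real \<Rightarrow> 'a \<Rightarrow> real) \<Rightarrow> bool"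
  where "stationary_solution M b \<sigma> B X \<longleftrightarrow>
    sde_solution M b \<sigma> B X \<and> stationary_process M X"

(* R^n is the set of extensional functions on {1..n}. *)
definition d1_metric :: "nat \<Rightarrow> (nat \<Rightarrow> real) metric"
  where "d1_metric n = metric ({1..n} \<rightarrow>\<^sub>E UNIV, \<lambda>x y. \<Sum>i=1..n. \<bar>y i - x i\<bar>)"

lemma Metric_space_d1:
  fixes n :: nat
  shows "Metric_space ({1..n} \<rightarrow>\<^sub>E UNIV) (\<lambda>x y. \<Sum>i=1..n. \<bar>y i - x i :: real\<bar>)"
proof
  fix x y z :: "nat \<Rightarrow> real"
  show "0 \<le> (\<Sum>i=1..n. \<bar>y i - x i\<bar>)" by (simp add: sum_nonneg)
  show "(\<Sum>i=1..n. \<bar>y i - x i\<bar>) = (\<Sum>i=1..n. \<bar>x i - y i\<bar>)"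
    by (simp add: abs_minus_commute)
  show "(\<Sum>i=1..n. \<bar>y i - x i\<bar>) = 0 \<longleftrightarrow> x = y"
    if "x \<in> {1..n} \<rightarrow>\<^sub>E UNIV" "y \<in> {1..n} \<rightarrow>\<^sub>E UNIV"
  proof
    assume "(\<Sum>i=1..n. \<bar>y i - x i\<bar>) = 0"
    then have "\<forall>i\<in>{1..n}. x i = y i"
      by (subst (asm) sum_nonneg_eq_0_iff) auto
    with that show "x = y" by (intro PiE_ext) auto
  qed simp
  show "(\<Sum>i=1..n. \<bar>z i - x i\<bar>) \<le> (\<Sum>i=1..n. \<bar>y i - x i\<bar>) + (\<Sum>i=1..n. \<bar>z i - y i\<bar>)"
    unfolding sum.distrib[symmetric] by (rule sum_mono) linarith
qed

lemma mspace_d1_metric [simp]: "mspace (d1_metric n) = {1..n} \<rightarrow>\<^sub>E UNIV"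
  unfolding d1_metric_def by (rule Metric_space.mspace_metric[OF Metric_space_d1])

lemma mdist_d1_metric [simp]:
  "mdist (d1_metric n) = (\<lambda>x y. \<Sum>i=1..n. \<bar>y i - x i\<bar>)"
  unfolding d1_metric_def by (rule Metric_space.mdist_metric[OF Metric_space_d1])

(* Only meaningful for Lipschitz g: the infimum of the empty set is unspecified. *)
definition lip_seminorm :: "'a metric \<Rightarrow> ('a \<Rightarrow> real) \<Rightarrow> real"
  where "lip_seminorm d g =
    Inf {L. 0 \<le> L \<and> (\<forall>x\<in>mspace d. \<forall>y\<in>mspace d. \<bar>g x - g y\<bar> \<le> L * mdist d x y)}"

definition sample ::
    "(real \<Rightarrow> 'a \<Rightarrow> real) \<Rightarrow> (nat \<Rightarrow> real) \<Rightarrow> nat \<Rightarrow> 'a \<Rightarrow> nat \<Rightarrow> real"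
  where "sample X \<Delta> n \<omega> = (\<lambda>i\<in>{1..n}. X (real i * \<Delta> n) \<omega>)"

definition expo_a :: "real \<Rightarrow> real"
  where "expo_a H = max (2 * H) 1"

definition expo_b :: "real \<Rightarrow> real"
  where "expo_b H = min 1 (2 - 2 * H)"

definition concentration_constant ::
    "'a measure \<Rightarrow> real \<Rightarrow> (real \<Rightarrow> 'a \<Rightarrow> real) \<Rightarrow> (nat \<Rightarrow> real) \<Rightarrow> real \<Rightarrow> bool"
  (* The explicit zero case is needed because r / 0 = 0 would turn the bound into 1. *)
  where "concentration_constant M H X \<Delta> c \<longleftrightarrow> c > 0 \<and>
    (\<forall>n\<ge>1. \<forall>F. Lipschitz_continuous_map (d1_metric n) euclidean_metric F \<longrightarrow>
      (\<forall>r>0. measure M {\<omega> \<in> space M.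
               F (sample X \<Delta> n \<omega>) - (\<integral>\<omega>'. F (sample X \<Delta> n \<omega>') \<partial>M) > r}
        \<le> (if lip_seminorm (d1_metric n) F = 0 then 0
           else exp (- (r\<^sup>2 / (c * (lip_seminorm (d1_metric n) F)\<^sup>2
                         * real n powr expo_a H * \<Delta> n powr (- expo_b H)))))))"

definition L2_on :: "real set \<Rightarrow> (real \<Rightarrow> real) set"
  where "L2_on I = {g. set_borel_measurable lborel I g \<and>
                       set_integrable lborel I (\<lambda>x. (g x)\<^sup>2)}"

definition L2_inner :: "real set \<Rightarrow> (real \<Rightarrow> real) \<Rightarrow> (real \<Rightarrow> real) \<Rightarrow> real"
  where "L2_inner I g h = (LBINT x:I. g x * h x)"

definition L2_norm :: "real set \<Rightarrow> (real \<Rightarrow> real) \<Rightarrow> real"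
  where "L2_norm I g = sqrt (L2_inner I g g)"

definition orthonormal_family :: "real set \<Rightarrow> nat \<Rightarrow> (nat \<Rightarrow> real \<Rightarrow> real) \<Rightarrow> bool"
  where "orthonormal_family I m \<phi> \<longleftrightarrow>
    (\<forall>j\<in>{1..m}. \<phi> j \<in> L2_on I) \<and>
    (\<forall>j\<in>{1..m}. \<forall>k\<in>{1..m}. L2_inner I (\<phi> j) (\<phi> k) = (if j = k then 1 else 0))"

definition span_of :: "nat \<Rightarrow> (nat \<Rightarrow> real \<Rightarrow> real) \<Rightarrow> (real \<Rightarrow> real) set"
  where "span_of m \<phi> = {(\<lambda>x. \<Sum>j=1..m. a j * \<phi> j x) | a. True}"

definition proj_estimator ::
    "nat \<Rightarrow> (nat \<Rightarrow> real \<Rightarrow> real) \<Rightarrow> nat \<Rightarrow> (nat \<Rightarrow> real) \<Rightarrow> real \<Rightarrow> real"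
  where "proj_estimator m \<phi> n \<xi> x =
    (\<Sum>j=1..m. (1 / real n * (\<Sum>i=1..n. \<phi> j (\<xi> i))) * \<phi> j x)"

definition lip_sum :: "nat \<Rightarrow> (nat \<Rightarrow> real \<Rightarrow> real) \<Rightarrow> real"
  where "lip_sum m \<phi> = (\<Sum>j=1..m. (lip_seminorm euclidean_metric (\<phi> j))\<^sup>2)"

end

theory Submission
  imports Defs
begin

text \<open>
  The risk splits into bias and variance. Since \<open>\<phi>\<^sub>1, \<dots>, \<phi>\<^sub>m\<close> are orthonormal, Pythagoras
  (\<open>orthonormal_expansion_error\<close>) shows that for any coefficients \<open>d\<^sub>j\<close> the squared distance from
  \<open>\<Sum>\<^sub>j d\<^sub>j \<phi>\<^sub>j\<close> to \<open>f\<close> is \<open>\<Sum>\<^sub>j (d\<^sub>j - a\<^sub>j)\<^sup>2\<close> plus the squared distance from \<open>f\<close> to its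
  projection, where \<open>a\<^sub>j\<close> is the inner product of \<open>\<phi>\<^sub>j\<close> and \<open>f\<close>. The second term is therefore
  the minimum over the span. The coefficients of the estimator are empirical means of
  \<open>\<phi>\<^sub>j\<close> along the sample; by stationarity, and because \<open>f\<close> is the density of \<open>X\<^sub>0\<close>, their expectations
  are exactly \<open>a\<^sub>j\<close>, so the first term has as expectation the sum of their variances.

  The variances come from the concentration inequality (\<open>empirical_mean_variance_le\<close>). With respect
  to \<open>d\<^sub>1\<close>, an empirical mean of \<open>g\<close> has Lipschitz semi-norm at most that of \<open>g\<close> divided by \<open>n\<close>.
  As \<open>max (2H) 1 - 2 = - min 1 (2 - 2H)\<close>, the factor \<open>n\<^sup>-\<^sup>2\<close> obtained from squaring turns the
  scale in the exponent into \<open>K = c Lip(g)\<^sup>2 / (n \<Delta>\<^sub>n)\<^sup>\<beta>\<close> with \<open>\<beta> = min 1 (2 - 2H)\<close>. Applying the inequality to \<open>g\<close> and \<open>- g\<close>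
  gives two-sided tails \<open>exp (- r\<^sup>2 / K)\<close>, and integrating those tails bounds the second moment by
  \<open>2K\<close> (\<open>second_moment_le_of_gaussian_tails\<close>). Summing over \<open>j\<close> gives
  \<open>2 c L(m) / (n \<Delta>\<^sub>n)\<^sup>\<beta>\<close>, which is at most the claimed bound because \<open>m \<ge> 1\<close>.
\<close>

section \<open>From Gaussian tails to second moments\<close>

text \<open>
  Layer cake: by Fubini the second moment is the integral over \<open>s > 0\<close> of the probability that
  \<open>Z\<^sup>2 > s\<close>. The tails at \<open>r = sqrt s\<close> bound it by \<open>2 exp (- s / K)\<close>, whose integral is \<open>2K\<close>.
\<close>
lemma (in prob_space) second_moment_le_of_gaussian_tails:
  fixes Z :: "'a \<Rightarrow> real"
  assumes [measurable]: "random_variable borel Z"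
    and K: "K > 0"
    and upper: "\<And>r. r > 0 \<Longrightarrow> prob {\<omega>\<in>space M. Z \<omega> > r} \<le> exp (- (r\<^sup>2 / K))"
    and lower: "\<And>r. r > 0 \<Longrightarrow> prob {\<omega>\<in>space M. - Z \<omega> > r} \<le> exp (- (r\<^sup>2 / K))"
  shows "expectation (\<lambda>\<omega>. (Z \<omega>)\<^sup>2) \<le> 2 * K"
proof -
  interpret P: pair_sigma_finite M lborel
    by unfold_locales
  have tail: "emeasure M {\<omega>\<in>space M. (Z \<omega>)\<^sup>2 > s} \<le> ennreal (2 * exp (- s / K))"
    if "s > 0" for s
  proof -
    have pos: "sqrt s > 0" and sq: "(sqrt s)\<^sup>2 = s" using that by auto
    have "{\<omega>\<in>space M. (Z \<omega>)\<^sup>2 > s}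
        \<subseteq> {\<omega>\<in>space M. Z \<omega> > sqrt s} \<union> {\<omega>\<in>space M. - Z \<omega> > sqrt s}"
    proof -
      have "z > sqrt s \<or> - z > sqrt s" if "z\<^sup>2 > s" for z :: real
        using real_sqrt_less_mono[OF that] by (auto simp: abs_if split: if_splits)
      then show ?thesis by blast
    qed
    then have "prob {\<omega>\<in>space M. (Z \<omega>)\<^sup>2 > s}
        \<le> prob ({\<omega>\<in>space M. Z \<omega> > sqrt s} \<union> {\<omega>\<in>space M. - Z \<omega> > sqrt s})"
      by (intro finite_measure_mono) measurable
    also have "\<dots> \<le> prob {\<omega>\<in>space M. Z \<omega> > sqrt s} + prob {\<omega>\<in>space M. - Z \<omega> > sqrt s}"
      by (intro measure_Un_le) measurable
    also have "\<dots> \<le> 2 * exp (- s / K)"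
      using upper[OF pos] lower[OF pos] by (simp add: sq)
    finally show ?thesis
      by (simp add: emeasure_eq_measure)
  qed
  have exp_int: "(\<integral>\<^sup>+s. ennreal (2 * exp (- s / K)) * indicator {0..} s \<partial>lborel) = ennreal (0 - - 2 * K)"
  proof -
    have "(\<integral>\<^sup>+s. ennreal (2 * exp (- s / K)) * indicator {0..} s \<partial>lborel)
        = ennreal (0 - (- (2 * K) * exp (- 0 / K)))"
    proof (rule nn_integral_FTC_atLeast)
      show "((\<lambda>s. - (2 * K) * exp (- s / K)) has_real_derivative 2 * exp (- s / K)) (at s)" for s
        using K by (auto intro!: derivative_eq_intros)
      have "filterlim (\<lambda>s. inverse K * s) at_top at_top"
        using K by (intro filterlim_tendsto_pos_mult_at_top[OF tendsto_const _ filterlim_ident]) auto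
      then have "filterlim (\<lambda>s. - s / K) at_bot at_top"
        by (simp add: filterlim_uminus_at_top divide_inverse mult.commute)
      then have "((\<lambda>s. exp (- s / K)) \<longlongrightarrow> 0) at_top"
        by (rule filterlim_compose[OF exp_at_bot])
      from tendsto_mult_left[OF this, of "- (2 * K)"]
      show "((\<lambda>s. - (2 * K) * exp (- s / K)) \<longlongrightarrow> 0) at_top" by simp
    qed auto
    then show ?thesis by simp
  qed
  have "(\<integral>\<^sup>+\<omega>. ennreal ((Z \<omega>)\<^sup>2) \<partial>M)
      = (\<integral>\<^sup>+\<omega>. (\<integral>\<^sup>+s. indicator {p. 0 < snd p \<and> snd p < (Z (fst p))\<^sup>2} (\<omega>, s) \<partial>lborel) \<partial>M)"
  proof (intro nn_integral_cong)
    fix \<omega>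
    have "(\<integral>\<^sup>+s. indicator {p. 0 < snd p \<and> snd p < (Z (fst p))\<^sup>2} (\<omega>, s) \<partial>lborel)
        = (\<integral>\<^sup>+s. indicator {0<..<(Z \<omega>)\<^sup>2} s \<partial>lborel)"
      by (intro nn_integral_cong) (auto simp: indicator_def)
    then show "ennreal ((Z \<omega>)\<^sup>2)
        = (\<integral>\<^sup>+s. indicator {p. 0 < snd p \<and> snd p < (Z (fst p))\<^sup>2} (\<omega>, s) \<partial>lborel)"
      by simp
  qed
  also have "\<dots> = (\<integral>\<^sup>+s. (\<integral>\<^sup>+\<omega>. indicator {p. 0 < snd p \<and> snd p < (Z (fst p))\<^sup>2} (\<omega>, s) \<partial>M) \<partial>lborel)"
    by (rule P.Fubini'[symmetric]) measurable
  also have "\<dots> \<le> (\<integral>\<^sup>+s. ennreal (2 * exp (- s / K)) * indicator {0..} s \<partial>lborel)"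
  proof (intro nn_integral_mono)
    fix s :: real
    show "(\<integral>\<^sup>+\<omega>. indicator {p. 0 < snd p \<and> snd p < (Z (fst p))\<^sup>2} (\<omega>, s) \<partial>M)
        \<le> ennreal (2 * exp (- s / K)) * indicator {0..} s"
    proof (cases "s > 0")
      case True
      have "(\<integral>\<^sup>+\<omega>. indicator {p. 0 < snd p \<and> snd p < (Z (fst p))\<^sup>2} (\<omega>, s) \<partial>M)
          = (\<integral>\<^sup>+\<omega>. indicator {\<omega>\<in>space M. (Z \<omega>)\<^sup>2 > s} \<omega> \<partial>M)"
        by (intro nn_integral_cong) (use True in \<open>auto simp: indicator_def\<close>)
      also have "\<dots> = emeasure M {\<omega>\<in>space M. (Z \<omega>)\<^sup>2 > s}"
        by (intro nn_integral_indicator) measurable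
      finally show ?thesis using tail[OF True] True by simp
    qed simp
  qed
  finally have "(\<integral>\<^sup>+\<omega>. ennreal ((Z \<omega>)\<^sup>2) \<partial>M) \<le> ennreal (2 * K)"
    unfolding exp_int by simp
  then have "enn2real (\<integral>\<^sup>+\<omega>. ennreal ((Z \<omega>)\<^sup>2) \<partial>M) \<le> 2 * K"
    using K by (intro enn2real_leI) auto
  then show ?thesis
    by (subst integral_eq_nn_integral) auto
qed

section \<open>Lipschitz semi-norms and empirical means\<close>

text \<open>
  For a Lipschitz map the infimum that defines the semi-norm is itself a Lipschitz constant:
  after division by a positive distance, every admissible constant bounds the same quotient.
\<close>
lemma abs_diff_le_lip_seminorm:
  assumes g: "Lipschitz_continuous_map d euclidean_metric g"
    and xy: "x \<in> mspace d" "y \<in> mspace d"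
  shows "\<bar>g x - g y\<bar> \<le> lip_seminorm d g * mdist d x y"
proof (cases "mdist d x y = 0")
  case True
  moreover from this have "x = y" using xy by simp
  ultimately show ?thesis by simp
next
  case False
  then have pos: "mdist d x y > 0" by (simp add: less_le)
  obtain B where "B > 0" "\<And>x y. x \<in> mspace d \<Longrightarrow> y \<in> mspace d \<Longrightarrow> \<bar>g x - g y\<bar> \<le> B * mdist d x y"
    using g by (auto simp: Lipschitz_continuous_map_pos dist_real_def)
  then have "B \<in> {L. 0 \<le> L \<and> (\<forall>x\<in>mspace d. \<forall>y\<in>mspace d. \<bar>g x - g y\<bar> \<le> L * mdist d x y)}"
    by auto
  then have "\<bar>g x - g y\<bar> / mdist d x y \<le> lip_seminorm d g"
    unfolding lip_seminorm_def
    by (intro cInf_greatest) (use xy pos in \<open>auto simp: divide_le_eq\<close>)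
  then show ?thesis using pos by (simp add: divide_le_eq)
qed

lemma lip_seminorm_le:
  assumes "0 \<le> L" "\<And>x y. x \<in> mspace d \<Longrightarrow> y \<in> mspace d \<Longrightarrow> \<bar>g x - g y\<bar> \<le> L * mdist d x y"
  shows "lip_seminorm d g \<le> L"
  unfolding lip_seminorm_def
  by (intro cInf_lower bdd_belowI[of _ 0]) (use assms in auto)

lemma lip_seminorm_nonneg:
  assumes "Lipschitz_continuous_map d euclidean_metric g"
  shows "0 \<le> lip_seminorm d g"
  unfolding lip_seminorm_def
proof (intro cInf_greatest)
  obtain B where "B > 0" "\<And>x y. x \<in> mspace d \<Longrightarrow> y \<in> mspace d \<Longrightarrow> \<bar>g x - g y\<bar> \<le> B * mdist d x y"
    using assms by (auto simp: Lipschitz_continuous_map_pos dist_real_def)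
  then show "{L. 0 \<le> L \<and> (\<forall>x\<in>mspace d. \<forall>y\<in>mspace d. \<bar>g x - g y\<bar> \<le> L * mdist d x y)} \<noteq> {}"
    by (auto intro!: exI[of _ B])
qed auto

definition empirical_mean :: "nat \<Rightarrow> (real \<Rightarrow> real) \<Rightarrow> (nat \<Rightarrow> real) \<Rightarrow> real"
  where "empirical_mean n g \<xi> = 1 / real n * (\<Sum>i=1..n. g (\<xi> i))"

lemma empirical_mean_diff_le:
  assumes "Lipschitz_continuous_map euclidean_metric euclidean_metric g"
  shows "\<bar>empirical_mean n g \<xi> - empirical_mean n g \<eta>\<bar>
    \<le> (lip_seminorm euclidean_metric g / real n) * mdist (d1_metric n) \<xi> \<eta>"
proof -
  have "\<bar>empirical_mean n g \<xi> - empirical_mean n g \<eta>\<bar> = \<bar>\<Sum>i=1..n. g (\<xi> i) - g (\<eta> i)\<bar> / real n"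
    by (simp add: empirical_mean_def sum_subtractf diff_divide_distrib[symmetric])
  also have "\<dots> \<le> (\<Sum>i=1..n. lip_seminorm euclidean_metric g * \<bar>\<eta> i - \<xi> i\<bar>) / real n"
  proof (intro divide_right_mono order_trans[OF sum_abs] sum_mono)
    show "\<bar>g (\<xi> i) - g (\<eta> i)\<bar> \<le> lip_seminorm euclidean_metric g * \<bar>\<eta> i - \<xi> i\<bar>" for i
      using abs_diff_le_lip_seminorm[OF assms, of "\<xi> i" "\<eta> i"]
      by (simp add: dist_real_def abs_minus_commute)
  qed simp
  also have "\<dots> = (lip_seminorm euclidean_metric g / real n) * mdist (d1_metric n) \<xi> \<eta>"
    by (simp add: sum_distrib_left[symmetric])
  finally show ?thesis .
qed

lemma empirical_mean_Lipschitz: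
  assumes "Lipschitz_continuous_map euclidean_metric euclidean_metric g"
  shows "Lipschitz_continuous_map (d1_metric n) euclidean_metric (empirical_mean n g)"
    and "lip_seminorm (d1_metric n) (empirical_mean n g) \<le> lip_seminorm euclidean_metric g / real n"
proof -
  show "Lipschitz_continuous_map (d1_metric n) euclidean_metric (empirical_mean n g)"
    using empirical_mean_diff_le[OF assms, of n]
    unfolding Lipschitz_continuous_map_def mdist_euclidean_metric dist_real_def mspace_euclidean_metric
    by blast
  show "lip_seminorm (d1_metric n) (empirical_mean n g) \<le> lip_seminorm euclidean_metric g / real n"
    using lip_seminorm_nonneg[OF assms] empirical_mean_diff_le[OF assms, of n]
    by (intro lip_seminorm_le) auto
qed

lemma Lipschitz_borel_measurable:
  fixes g :: "real \<Rightarrow> real"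
  assumes "Lipschitz_continuous_map euclidean_metric euclidean_metric g"
  shows "g \<in> borel_measurable borel"
proof (rule borel_measurable_continuous_onI)
  show "continuous_on UNIV g"
    using Lipschitz_continuous_imp_continuous_map[OF assms] by simp
qed

section \<open>One-dimensional marginals of a stationary process\<close>

text \<open>
  Stationarity is a property of finite-dimensional laws; the family indexed by \<open>{0}\<close>, shifted
  by \<open>t\<close>, already identifies the law of \<open>X\<^sub>t\<close> with that of \<open>X\<^sub>0\<close>.
\<close>
lemma stationary_integral_eq:
  fixes g :: "real \<Rightarrow> real"
  assumes X: "stationary_process M X" and t: "t \<ge> 0"
    and g[measurable]: "g \<in> borel_measurable borel"
  shows "(\<integral>\<omega>. g (X t \<omega>) \<partial>M) = (\<integral>\<omega>. g (X 0 \<omega>) \<partial>M)"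
proof -
  have [measurable]: "X s \<in> borel_measurable M" if "s \<ge> 0" for s
    using X that by (auto simp: stationary_process_def)
  let ?P = "PiM {0::real} (\<lambda>_. borel :: real measure)"
  have meas: "(\<lambda>\<omega>. \<lambda>s\<in>{0}. X (s + h) \<omega>) \<in> measurable M ?P" if "h \<ge> 0" for h
    using that by (intro measurable_restrict) auto
  have int: "(\<integral>x. g (x 0) \<partial>distr M ?P (\<lambda>\<omega>. \<lambda>s\<in>{0}. X (s + h) \<omega>)) = (\<integral>\<omega>. g (X h \<omega>) \<partial>M)"
    if "h \<ge> 0" for h
    by (subst integral_distr[OF meas[OF that]]) (auto intro!: measurable_compose[OF measurable_component_singleton])
  have "distr M ?P (\<lambda>\<omega>. \<lambda>s\<in>{0}. X (s + t) \<omega>) = distr M ?P (\<lambda>\<omega>. \<lambda>s\<in>{0}. X s \<omega>)"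
    using X t unfolding stationary_process_def by blast
  then show ?thesis
    using int[OF t] int[of 0] by simp
qed

section \<open>Orthonormal expansions\<close>

text \<open>The product is dominated by \<open>g\<^sup>2 + h\<^sup>2\<close>.\<close>
lemma L2_on_mult_integrable:
  assumes "g \<in> L2_on I" "h \<in> L2_on I"
  shows "set_integrable lborel I (\<lambda>x. g x * h x)"
proof -
  have [measurable]: "(\<lambda>x. indicator I x *\<^sub>R g x) \<in> borel_measurable lborel"
    "(\<lambda>x. indicator I x *\<^sub>R h x) \<in> borel_measurable lborel"
    using assms by (auto simp: L2_on_def set_borel_measurable_def)
  have eq: "(\<lambda>x. indicator I x *\<^sub>R (g x * h x)) = (\<lambda>x. (indicator I x *\<^sub>R g x) * (indicator I x *\<^sub>R h x))"
    by (auto simp: indicator_def)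
  have "integrable lborel (\<lambda>x. indicator I x *\<^sub>R (g x)\<^sup>2 + indicator I x *\<^sub>R (h x)\<^sup>2)"
    using assms by (intro Bochner_Integration.integrable_add) (auto simp: L2_on_def set_integrable_def)
  then show ?thesis
    unfolding set_integrable_def
  proof (rule Bochner_Integration.integrable_bound)
    show "(\<lambda>x. indicator I x *\<^sub>R (g x * h x)) \<in> borel_measurable lborel"
      unfolding eq by measurable
    have "\<bar>u * v\<bar> \<le> u\<^sup>2 + v\<^sup>2" for u v :: real
      using sum_squares_bound[of "\<bar>u\<bar>" "\<bar>v\<bar>"] by (auto simp: abs_mult intro: order_trans[rotated])
    then show "AE x in lborel. norm (indicator I x *\<^sub>R (g x * h x))
        \<le> norm (indicator I x *\<^sub>R (g x)\<^sup>2 + indicator I x *\<^sub>R (h x)\<^sup>2)"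
      by (intro AE_I2) (auto simp: indicator_def)
  qed
qed

lemma L2_inner_sum_left:
  assumes "\<And>j. j \<in> J \<Longrightarrow> u j \<in> L2_on I" "h \<in> L2_on I"
  shows "L2_inner I (\<lambda>x. \<Sum>j\<in>J. d j * u j x) h = (\<Sum>j\<in>J. d j * L2_inner I (u j) h)"
proof -
  have "L2_inner I (\<lambda>x. \<Sum>j\<in>J. d j * u j x) h = (LBINT x. \<Sum>j\<in>J. d j * (indicator I x *\<^sub>R (u j x * h x)))"
    unfolding L2_inner_def set_lebesgue_integral_def
    by (intro Bochner_Integration.integral_cong) (auto simp: sum_distrib_left sum_distrib_right algebra_simps)
  also have "\<dots> = (\<Sum>j\<in>J. LBINT x. d j * (indicator I x *\<^sub>R (u j x * h x)))"
    using L2_on_mult_integrable[OF assms(1) assms(2)]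
    by (intro Bochner_Integration.integral_sum integrable_mult_right) (auto simp: set_integrable_def)
  finally show ?thesis by (simp add: L2_inner_def set_lebesgue_integral_def)
qed

lemma set_integrable_sum:
  fixes g :: "'i \<Rightarrow> real \<Rightarrow> real"
  assumes "\<And>j. j \<in> J \<Longrightarrow> set_integrable M I (g j)"
  shows "set_integrable M I (\<lambda>x. \<Sum>j\<in>J. g j x)"
proof -
  have "integrable M (\<lambda>x. \<Sum>j\<in>J. indicator I x *\<^sub>R g j x)"
    using assms by (intro Bochner_Integration.integrable_sum) (auto simp: set_integrable_def)
  then show ?thesis by (simp add: set_integrable_def sum_distrib_left)
qed

lemma L2_on_sum:
  assumes "finite J" "\<And>j. j \<in> J \<Longrightarrow> u j \<in> L2_on I"
  shows "(\<lambda>x. \<Sum>j\<in>J. d j * u j x) \<in> L2_on I"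
proof -
  have eq: "(\<lambda>x. indicator I x *\<^sub>R (\<Sum>j\<in>J. d j * u j x)) = (\<lambda>x. \<Sum>j\<in>J. d j * (indicator I x *\<^sub>R u j x))"
    by (auto simp: sum_distrib_left algebra_simps)
  have "set_borel_measurable lborel I (\<lambda>x. \<Sum>j\<in>J. d j * u j x)"
    using assms unfolding set_borel_measurable_def eq
    by (intro borel_measurable_sum borel_measurable_times) (auto simp: L2_on_def set_borel_measurable_def)
  moreover have "set_integrable lborel I (\<lambda>x. (\<Sum>j\<in>J. d j * u j x)\<^sup>2)"
  proof -
    have eq2: "(\<Sum>j\<in>J. d j * u j x)\<^sup>2 = (\<Sum>j\<in>J. \<Sum>k\<in>J. (d j * d k) * (u j x * u k x))" for x
      by (simp add: power2_eq_square sum_product algebra_simps)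
    show ?thesis
      unfolding eq2 using assms(1)
      by (intro set_integrable_sum set_integrable_mult_right L2_on_mult_integrable assms(2))
  qed
  ultimately show ?thesis by (simp add: L2_on_def)
qed

lemma L2_norm_sq: "(L2_norm I g)\<^sup>2 = L2_inner I g g"
proof -
  have "L2_inner I g g \<ge> 0"
    unfolding L2_inner_def set_lebesgue_integral_def
    by (intro integral_nonneg_AE AE_I2) (auto simp: indicator_def)
  then show ?thesis by (simp add: L2_norm_def)
qed

lemma L2_norm_diff_sq:
  assumes "g \<in> L2_on I" "h \<in> L2_on I"
  shows "(L2_norm I (\<lambda>x. g x - h x))\<^sup>2 = L2_inner I g g - 2 * L2_inner I g h + L2_inner I h h"
proof -
  note ints = L2_on_mult_integrable[OF assms(1) assms(1)] L2_on_mult_integrable[OF assms]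
    L2_on_mult_integrable[OF assms(2) assms(2)]
  have "(g x - h x) * (g x - h x) = g x * g x - 2 * (g x * h x) + h x * h x" for x
    by (simp add: algebra_simps)
  then show ?thesis
    unfolding L2_norm_sq L2_inner_def using ints
    by (simp add: set_integral_add set_integral_diff)
qed

text \<open>
  Expanding the square and completing it in each coordinate gives
  \<open>\<Sum>\<^sub>j (d\<^sub>j - a\<^sub>j)\<^sup>2 + (\<parallel>f\<parallel>\<^sup>2 - \<Sum>\<^sub>j a\<^sub>j\<^sup>2)\<close> with \<open>a\<^sub>j\<close> the inner product of \<open>\<phi>\<^sub>j\<close> and \<open>f\<close>.
  The case \<open>d = a\<close> identifies the remainder as the squared error of the projection.
\<close>
lemma orthonormal_expansion_error:
  assumes on: "orthonormal_family I m \<phi>" and f: "f \<in> L2_on I"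
  shows "(L2_norm I (\<lambda>x. (\<Sum>j=1..m. d j * \<phi> j x) - f x))\<^sup>2
    = (\<Sum>j=1..m. (d j - L2_inner I (\<phi> j) f)\<^sup>2)
      + (L2_norm I (\<lambda>x. (\<Sum>j=1..m. L2_inner I (\<phi> j) f * \<phi> j x) - f x))\<^sup>2"
proof -
  have phi: "\<phi> j \<in> L2_on I" if "j \<in> {1..m}" for j
    using on that by (simp add: orthonormal_family_def)
  have comm: "L2_inner I g h = L2_inner I h g" for g h
    by (simp add: L2_inner_def mult.commute)
  have expand: "(L2_norm I (\<lambda>x. (\<Sum>j=1..m. e j * \<phi> j x) - f x))\<^sup>2
      = (\<Sum>j=1..m. (e j - L2_inner I (\<phi> j) f)\<^sup>2) + (L2_inner I f f - (\<Sum>j=1..m. (L2_inner I (\<phi> j) f)\<^sup>2))"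
    for e
  proof -
    let ?g = "\<lambda>x. \<Sum>j=1..m. e j * \<phi> j x"
    have g: "?g \<in> L2_on I" by (intro L2_on_sum phi) auto
    have coeff: "L2_inner I (\<phi> k) ?g = e k" if k: "k \<in> {1..m}" for k
    proof -
      have "L2_inner I (\<phi> k) ?g = (\<Sum>j=1..m. e j * L2_inner I (\<phi> j) (\<phi> k))"
        by (subst comm, rule L2_inner_sum_left) (use phi k in auto)
      also have "\<dots> = (\<Sum>j=1..m. if j = k then e j else 0)"
        using on k by (intro sum.cong) (auto simp: orthonormal_family_def)
      finally show ?thesis using k by simp
    qed
    have gg: "L2_inner I ?g ?g = (\<Sum>j=1..m. (e j)\<^sup>2)"
    proof -
      have "L2_inner I ?g ?g = (\<Sum>j=1..m. e j * L2_inner I (\<phi> j) ?g)"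
        by (rule L2_inner_sum_left[OF phi g])
      also have "\<dots> = (\<Sum>j=1..m. (e j)\<^sup>2)"
        by (intro sum.cong refl) (simp only: coeff power2_eq_square)
      finally show ?thesis .
    qed
    have gf: "L2_inner I ?g f = (\<Sum>j=1..m. e j * L2_inner I (\<phi> j) f)"
      by (rule L2_inner_sum_left[OF phi f])
    show ?thesis
      unfolding L2_norm_diff_sq[OF g f] gg gf
      by (simp add: power2_diff sum.distrib sum_subtractf sum_distrib_left algebra_simps)
  qed
  show ?thesis
    unfolding expand by simp
qed

section \<open>The variance of an empirical mean\<close>

text \<open>
  The scale of the exponent is only required to be at most \<open>K\<close>, with \<open>K > 0\<close>. This absorbs the
  degenerate case of a constant \<open>g\<close>, in which the scale vanishes and so does the tail.
\<close>
lemma empirical_mean_upper_tail: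
  assumes conc: "concentration_constant M H X \<Delta> c" and n: "n \<ge> 1" and pos: "\<Delta> n > 0"
    and g: "Lipschitz_continuous_map euclidean_metric euclidean_metric g"
    and K: "K > 0" "c * (lip_seminorm euclidean_metric g)\<^sup>2 / (real n * \<Delta> n) powr expo_b H \<le> K"
    and r: "r > 0"
  shows "measure M {\<omega> \<in> space M. empirical_mean n g (sample X \<Delta> n \<omega>)
      - (\<integral>\<omega>'. empirical_mean n g (sample X \<Delta> n \<omega>') \<partial>M) > r} \<le> exp (- (r\<^sup>2 / K))"
proof -
  let ?l = "lip_seminorm (d1_metric n) (empirical_mean n g)"
  let ?L = "lip_seminorm euclidean_metric g"
  let ?D = "c * ?l\<^sup>2 * real n powr expo_a H * \<Delta> n powr (- expo_b H)"
  have c: "c > 0" using conc by (simp add: concentration_constant_def)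
  have l0: "?l \<ge> 0" by (rule lip_seminorm_nonneg[OF empirical_mean_Lipschitz(1)[OF g]])
  have "measure M {\<omega> \<in> space M. empirical_mean n g (sample X \<Delta> n \<omega>)
      - (\<integral>\<omega>'. empirical_mean n g (sample X \<Delta> n \<omega>') \<partial>M) > r}
    \<le> (if ?l = 0 then 0 else exp (- (r\<^sup>2 / ?D)))"
    using conc n r empirical_mean_Lipschitz(1)[OF g, of n] unfolding concentration_constant_def by blast
  also have "\<dots> \<le> exp (- (r\<^sup>2 / K))"
  proof (cases "?l = 0")
    case False
    then have "?l > 0" using l0 by simp
    then have D: "?D > 0" using c n pos by simp
    \<comment> \<open>The powers of \<open>n\<close> combine to \<open>n powr (expo_a H - 2)\<close>, and \<open>expo_a H - 2\<close> is \<open>- expo_b H\<close>.\<close>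
    have "?D \<le> c * (?L / real n)\<^sup>2 * real n powr expo_a H * \<Delta> n powr (- expo_b H)"
      using empirical_mean_Lipschitz(2)[OF g, of n] l0 c
      by (intro mult_right_mono mult_left_mono power_mono) auto
    also have "\<dots> = c * ?L\<^sup>2 * (real n powr expo_a H / real n ^ 2) * \<Delta> n powr (- expo_b H)"
      by (simp add: power_divide)
    also have "real n powr expo_a H / real n ^ 2 = real n powr (- expo_b H)"
    proof -
      have "expo_a H - 2 = - expo_b H" by (simp add: expo_a_def expo_b_def)
      moreover have "real n ^ 2 = real n powr 2" using n by simp
      ultimately show ?thesis by (simp only: powr_diff[symmetric])
    qed
    also have "c * ?L\<^sup>2 * real n powr (- expo_b H) * \<Delta> n powr (- expo_b H)
        = c * ?L\<^sup>2 / (real n * \<Delta> n) powr expo_b H"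
      using n pos by (simp add: powr_minus powr_mult divide_inverse)
    also have "\<dots> \<le> K" by fact
    finally have "r\<^sup>2 / K \<le> r\<^sup>2 / ?D" using D by (intro divide_left_mono) auto
    then show ?thesis using False by simp
  qed simp
  finally show ?thesis .
qed

lemma Lipschitz_uminus:
  assumes "Lipschitz_continuous_map euclidean_metric euclidean_metric g"
  shows "Lipschitz_continuous_map euclidean_metric euclidean_metric (\<lambda>x. - g x :: real)"
    and "lip_seminorm euclidean_metric (\<lambda>x. - g x) = lip_seminorm euclidean_metric g"
  using assms by (auto simp: Lipschitz_continuous_map_def lip_seminorm_def dist_minus abs_minus_commute)

lemma empirical_mean_variance_le:
  assumes prob: "prob_space M" and conc: "concentration_constant M H X \<Delta> c"
    and n: "n \<ge> 1" and pos: "\<Delta> n > 0"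
    and g: "Lipschitz_continuous_map euclidean_metric euclidean_metric g"
    and meas: "(\<lambda>\<omega>. empirical_mean n g (sample X \<Delta> n \<omega>)) \<in> borel_measurable M"
  shows "(\<integral>\<omega>. (empirical_mean n g (sample X \<Delta> n \<omega>)
      - (\<integral>\<omega>'. empirical_mean n g (sample X \<Delta> n \<omega>') \<partial>M))\<^sup>2 \<partial>M)
    \<le> 2 * (c * (lip_seminorm euclidean_metric g)\<^sup>2 / (real n * \<Delta> n) powr expo_b H)"
  \<comment> \<open>Enlarging the scale by \<open>e / 2\<close> makes it positive even when \<open>g\<close> is constant.\<close>
proof (rule field_le_epsilon)
  fix e :: real assume e: "e > 0"
  interpret prob_space M by (rule prob)
  let ?K = "c * (lip_seminorm euclidean_metric g)\<^sup>2 / (real n * \<Delta> n) powr expo_b H"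
  let ?Y = "\<lambda>\<omega>. empirical_mean n g (sample X \<Delta> n \<omega>)"
  have "c > 0" using conc by (simp add: concentration_constant_def)
  then have K: "?K + e / 2 > 0" using e by (intro add_nonneg_pos) auto
  have neg: "empirical_mean n (\<lambda>x. - g x) \<xi> = - empirical_mean n g \<xi>" for \<xi>
    by (simp add: empirical_mean_def sum_negf)
  have "(\<integral>\<omega>. (?Y \<omega> - (\<integral>\<omega>'. ?Y \<omega>' \<partial>M))\<^sup>2 \<partial>M) \<le> 2 * (?K + e / 2)"
  proof (rule second_moment_le_of_gaussian_tails[OF _ K])
    show "(\<lambda>\<omega>. ?Y \<omega> - (\<integral>\<omega>'. ?Y \<omega>' \<partial>M)) \<in> borel_measurable M"
      using meas by simp
    fix r :: real assume r: "r > 0"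
    show "prob {\<omega>\<in>space M. ?Y \<omega> - (\<integral>\<omega>'. ?Y \<omega>' \<partial>M) > r} \<le> exp (- (r\<^sup>2 / (?K + e / 2)))"
      using e by (intro empirical_mean_upper_tail[OF conc n pos g K _ r]) auto
    have "prob {\<omega> \<in> space M. empirical_mean n (\<lambda>x. - g x) (sample X \<Delta> n \<omega>)
      - (\<integral>\<omega>'. empirical_mean n (\<lambda>x. - g x) (sample X \<Delta> n \<omega>') \<partial>M) > r} \<le> exp (- (r\<^sup>2 / (?K + e / 2)))"
      using e by (intro empirical_mean_upper_tail[OF conc n pos Lipschitz_uminus(1)[OF g] K _ r])
        (auto simp: Lipschitz_uminus(2)[OF g])
    then show "prob {\<omega>\<in>space M. - (?Y \<omega> - (\<integral>\<omega>'. ?Y \<omega>' \<partial>M)) > r} \<le> exp (- (r\<^sup>2 / (?K + e / 2)))"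
      by (simp add: neg algebra_simps)
  qed
  then show "(\<integral>\<omega>. (?Y \<omega> - (\<integral>\<omega>'. ?Y \<omega>' \<partial>M))\<^sup>2 \<partial>M) \<le> 2 * ?K + e" by simp
qed

section \<open>The risk bound\<close>

theorem proposition3p2:
  fixes M :: "'a measure"
    and H \<sigma> m\<^sub>b c :: real
    and b b' f :: "real \<Rightarrow> real"
    and B X :: "real \<Rightarrow> 'a \<Rightarrow> real"
    and \<Delta> :: "nat \<Rightarrow> real"
    and I :: "real set"
    and m n :: nat
    and \<phi> :: "nat \<Rightarrow> real \<Rightarrow> real"
  assumes prob: "prob_space M"
    and H: "0 < H" "H < 1"
    and sigma: "\<sigma> \<noteq> 0"
    and fbm: "fractional_brownian_motion M H B"
    and b_deriv: "\<And>x. (b has_real_derivative b' x) (at x)"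
    and b_C1: "continuous_on UNIV b'"
    and b_bdd: "bounded (range b')"
    and b_dissip: "m\<^sub>b > 0" "\<And>x. b' x \<le> - m\<^sub>b"
    and X: "stationary_solution M b \<sigma> B X"
    and f_nonneg: "\<And>x. 0 \<le> f x"
    and f_density: "distributed M lborel (X 0) (\<lambda>x. ennreal (f x))"
    and f_L2: "f \<in> L2_on UNIV"
    and Delta_pos: "\<And>k. k \<ge> 1 \<Longrightarrow> \<Delta> k > 0"
    and Delta_lim: "\<Delta> \<longlonglongrightarrow> 0"
    and Delta_horizon: "filterlim (\<lambda>k. real k * \<Delta> k) at_top sequentially"
    and conc: "concentration_constant M H X \<Delta> c"
    and I: "is_interval I"
    and m: "m \<ge> 1"
    and n: "n \<ge> 1"
    and phi_supp: "\<And>j x. j \<in> {1..m} \<Longrightarrow> x \<notin> I \<Longrightarrow> \<phi> j x = 0"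
    and phi_bdd: "\<And>j. j \<in> {1..m} \<Longrightarrow> bounded (range (\<phi> j))"
    and phi_lip: "\<And>j. j \<in> {1..m} \<Longrightarrow>
                    Lipschitz_continuous_map euclidean_metric euclidean_metric (\<phi> j)"
    and phi_onb: "orthonormal_family I m \<phi>"
  shows "integrable M (\<lambda>\<omega>. (L2_norm I (\<lambda>x. proj_estimator m \<phi> n (sample X \<Delta> n \<omega>) x - f x))\<^sup>2) \<and>
    (\<exists>t\<in>span_of m \<phi>.
      (\<forall>s\<in>span_of m \<phi>. (L2_norm I (\<lambda>x. t x - f x))\<^sup>2 \<le> (L2_norm I (\<lambda>x. s x - f x))\<^sup>2) \<and>
      (\<integral>\<omega>. (L2_norm I (\<lambda>x. proj_estimator m \<phi> n (sample X \<Delta> n \<omega>) x - f x))\<^sup>2 \<partial>M)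
        \<le> (L2_norm I (\<lambda>x. t x - f x))\<^sup>2
           + 2 * c * (real m * lip_sum m \<phi> / (real n * \<Delta> n) powr expo_b H))"
proof -
  interpret prob_space M by (rule prob)
  have X_meas[measurable]: "X t \<in> borel_measurable M" if "t \<ge> 0" for t
    using X that by (simp add: stationary_solution_def sde_solution_def)
  have stat: "stationary_process M X"
    using X by (simp add: stationary_solution_def)
  have I_borel[measurable]: "I \<in> sets borel"
    by (rule real_interval_borel_measurable[OF I])
  have f_meas[measurable]: "f \<in> borel_measurable borel" and f_sq: "integrable lborel (\<lambda>x. (f x)\<^sup>2)"
    using f_L2 by (auto simp: L2_on_def set_borel_measurable_def set_integrable_def)
  have f_I: "f \<in> L2_on I"
  proof -
    have "set_integrable lborel I (\<lambda>x. (f x)\<^sup>2)"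
      unfolding set_integrable_def using f_sq by (intro integrable_mult_indicator) auto
    then show ?thesis by (simp add: L2_on_def set_borel_measurable_def)
  qed
  have time: "real i * \<Delta> n \<ge> 0" for i
    using Delta_pos[OF n] by simp
  define Y where "Y j \<omega> = empirical_mean n (\<phi> j) (sample X \<Delta> n \<omega>)" for j \<omega>
  have Y_eq: "Y j \<omega> = 1 / real n * (\<Sum>i=1..n. \<phi> j (X (real i * \<Delta> n) \<omega>))" for j \<omega>
    by (simp add: Y_def empirical_mean_def sample_def)
  have phi_meas: "\<phi> j \<in> borel_measurable borel" if "j \<in> {1..m}" for j
    by (rule Lipschitz_borel_measurable[OF phi_lip[OF that]])
  have phi_X: "(\<lambda>\<omega>. \<phi> j (X t \<omega>)) \<in> borel_measurable M" if "j \<in> {1..m}" "t \<ge> 0" for j t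
    by (rule measurable_compose[OF X_meas[OF that(2)] phi_meas[OF that(1)]])
  have Y_meas: "Y j \<in> borel_measurable M" if "j \<in> {1..m}" for j
    unfolding Y_eq[abs_def] using phi_X[OF that time] by (intro borel_measurable_times borel_measurable_sum) auto
  have Y_bdd: "\<exists>C. \<forall>\<omega>. \<bar>Y j \<omega>\<bar> \<le> C" if j: "j \<in> {1..m}" for j
  proof -
    obtain C where C: "\<And>x. \<bar>\<phi> j x\<bar> \<le> C"
      using phi_bdd[OF j] by (auto simp: bounded_iff)
    have "\<bar>Y j \<omega>\<bar> \<le> 1 / real n * (\<Sum>i=1..n. C)" for \<omega>
      unfolding Y_eq abs_mult by (intro mult_mono order_trans[OF sum_abs] sum_mono C) auto
    then show ?thesis by blast
  qed
  define a where "a j = L2_inner I (\<phi> j) f" for j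
  \<comment> \<open>The integral against the density runs over the whole line, but \<open>\<phi> j\<close> vanishes off \<open>I\<close>.\<close>
  have mean_X0: "(\<integral>\<omega>. \<phi> j (X 0 \<omega>) \<partial>M) = a j" if j: "j \<in> {1..m}" for j
  proof -
    have "(\<integral>\<omega>. \<phi> j (X 0 \<omega>) \<partial>M) = (\<integral>x. f x * \<phi> j x \<partial>lborel)"
      using phi_meas[OF j] f_nonneg by (intro distributed_integral[OF f_density, symmetric]) auto
    also have "\<dots> = a j"
      unfolding a_def L2_inner_def set_lebesgue_integral_def
      by (intro Bochner_Integration.integral_cong) (auto simp: indicator_def phi_supp[OF j])
    finally show ?thesis .
  qed
  have phi_X_int: "integrable M (\<lambda>\<omega>. \<phi> j (X t \<omega>))" if j: "j \<in> {1..m}" and t: "t \<ge> 0" for j t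
  proof -
    obtain C where C: "\<And>x. \<bar>\<phi> j x\<bar> \<le> C"
      using phi_bdd[OF j] by (auto simp: bounded_iff)
    show ?thesis
      by (rule integrable_const_bound[where B = C]) (use C phi_X[OF j t] in auto)
  qed
  have Y_mean: "(\<integral>\<omega>. Y j \<omega> \<partial>M) = a j" if j: "j \<in> {1..m}" for j
  proof -
    have "(\<integral>\<omega>. Y j \<omega> \<partial>M) = 1 / real n * (\<Sum>i=1..n. \<integral>\<omega>. \<phi> j (X (real i * \<Delta> n) \<omega>) \<partial>M)"
      unfolding Y_eq using phi_X_int[OF j time] by simp
    also have "\<dots> = 1 / real n * (\<Sum>i=1..n. a j)"
      using stationary_integral_eq[OF stat time phi_meas[OF j]] mean_X0[OF j] by simp
    finally show ?thesis using n by simp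
  qed
  have dev_int: "integrable M (\<lambda>\<omega>. (Y j \<omega> - a j)\<^sup>2)" if j: "j \<in> {1..m}" for j
  proof -
    obtain C where C: "\<And>\<omega>. \<bar>Y j \<omega>\<bar> \<le> C" using Y_bdd[OF j] by blast
    have "\<bar>Y j \<omega> - a j\<bar> \<le> C + \<bar>a j\<bar>" for \<omega>
      using C[of \<omega>] by linarith
    then have "(Y j \<omega> - a j)\<^sup>2 \<le> (C + \<bar>a j\<bar>)\<^sup>2" for \<omega>
      using power_mono[of "\<bar>Y j \<omega> - a j\<bar>" "C + \<bar>a j\<bar>" 2] by simp
    then show ?thesis
      using Y_meas[OF j] by (intro integrable_const_bound[where B = "(C + \<bar>a j\<bar>)\<^sup>2"]) auto
  qed
  let ?t = "\<lambda>x. \<Sum>j=1..m. a j * \<phi> j x"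
  let ?bias = "(L2_norm I (\<lambda>x. ?t x - f x))\<^sup>2"
  have error: "(L2_norm I (\<lambda>x. proj_estimator m \<phi> n (sample X \<Delta> n \<omega>) x - f x))\<^sup>2
      = (\<Sum>j=1..m. (Y j \<omega> - a j)\<^sup>2) + ?bias" for \<omega>
    using orthonormal_expansion_error[OF phi_onb f_I, of "\<lambda>j. Y j \<omega>"]
    by (simp add: proj_estimator_def Y_def empirical_mean_def a_def)
  have best: "?bias \<le> (L2_norm I (\<lambda>x. s x - f x))\<^sup>2" if "s \<in> span_of m \<phi>" for s
  proof -
    obtain d where s: "s = (\<lambda>x. \<Sum>j=1..m. d j * \<phi> j x)"
      using \<open>s \<in> span_of m \<phi>\<close> by (auto simp: span_of_def)
    show ?thesis
      unfolding s orthonormal_expansion_error[OF phi_onb f_I, of d]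
      by (simp add: a_def sum_nonneg)
  qed
  let ?R = "(real n * \<Delta> n) powr expo_b H"
  have variance: "(\<integral>\<omega>. (Y j \<omega> - a j)\<^sup>2 \<partial>M)
      \<le> 2 * (c * (lip_seminorm euclidean_metric (\<phi> j))\<^sup>2 / ?R)" if j: "j \<in> {1..m}" for j
    using empirical_mean_variance_le[OF prob conc n Delta_pos[OF n] phi_lip[OF j]]
      Y_meas[OF j] Y_mean[OF j] unfolding Y_def by simp
  have "(\<integral>\<omega>. (L2_norm I (\<lambda>x. proj_estimator m \<phi> n (sample X \<Delta> n \<omega>) x - f x))\<^sup>2 \<partial>M)
      = (\<Sum>j=1..m. \<integral>\<omega>. (Y j \<omega> - a j)\<^sup>2 \<partial>M) + ?bias"
  proof -
    have "integrable M (\<lambda>\<omega>. \<Sum>j=1..m. (Y j \<omega> - a j)\<^sup>2)"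
      by (intro Bochner_Integration.integrable_sum dev_int)
    then have "(\<integral>\<omega>. (\<Sum>j=1..m. (Y j \<omega> - a j)\<^sup>2) + ?bias \<partial>M)
        = (\<integral>\<omega>. (\<Sum>j=1..m. (Y j \<omega> - a j)\<^sup>2) \<partial>M) + ?bias"
      by (simp add: prob_space)
    also have "(\<integral>\<omega>. (\<Sum>j=1..m. (Y j \<omega> - a j)\<^sup>2) \<partial>M) = (\<Sum>j=1..m. \<integral>\<omega>. (Y j \<omega> - a j)\<^sup>2 \<partial>M)"
      by (intro Bochner_Integration.integral_sum dev_int)
    finally show ?thesis unfolding error .
  qed
  also have "\<dots> \<le> (\<Sum>j=1..m. 2 * (c * (lip_seminorm euclidean_metric (\<phi> j))\<^sup>2 / ?R)) + ?bias"
    by (intro add_right_mono sum_mono variance)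
  also have "(\<Sum>j=1..m. 2 * (c * (lip_seminorm euclidean_metric (\<phi> j))\<^sup>2 / ?R)) = 2 * c * (lip_sum m \<phi> / ?R)"
    by (simp add: lip_sum_def sum_distrib_left sum_divide_distrib mult.assoc)
  also have "\<dots> \<le> 2 * c * (real m * lip_sum m \<phi> / ?R)"
  proof -
    have "lip_sum m \<phi> \<ge> 0" by (simp add: lip_sum_def sum_nonneg)
    then have "lip_sum m \<phi> \<le> real m * lip_sum m \<phi>"
      using m mult_right_mono[of 1 "real m" "lip_sum m \<phi>"] by simp
    moreover have "c > 0" using conc by (simp add: concentration_constant_def)
    ultimately show ?thesis by (intro mult_left_mono divide_right_mono) auto
  qed
  finally have risk: "(\<integral>\<omega>. (L2_norm I (\<lambda>x. proj_estimator m \<phi> n (sample X \<Delta> n \<omega>) x - f x))\<^sup>2 \<partial>M)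
      \<le> ?bias + 2 * c * (real m * lip_sum m \<phi> / ?R)"
    by simp
  have "integrable M (\<lambda>\<omega>. (L2_norm I (\<lambda>x. proj_estimator m \<phi> n (sample X \<Delta> n \<omega>) x - f x))\<^sup>2)"
    unfolding error using dev_int by (intro Bochner_Integration.integrable_add Bochner_Integration.integrable_sum) auto
  moreover have "?t \<in> span_of m \<phi>" by (auto simp: span_of_def)
  ultimately show ?thesis
    using best risk by (intro conjI bexI[of _ ?t] ballI)
qed

end
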